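(* (The Quadratic Recurrence.) Set $F_0(t,\beta)=F_1(t,\beta)=1$ for all $\beta\in\mathbb{C}$ and all $t\in\mathbb{R}$. For $N\geq 2$, $\operatorname{Re}(\beta)>-2/N$, and $t\in\mathbb{R}$, define $F_N(t,\beta)$ by the recurrence $$F_N(t,\beta):=\begin{cases}\displaystyle\sum_{k=1}^{N-1}\frac{k}{N}\cdot\frac{\sinh\left(\frac{t}{2}\left[\left(N+\binom{N}{2}\beta\right)\left(1-\frac{2k}{N}\right)+1\right]\right)}{\sinh\left(\frac{t}{2}\left[\left(N+\binom{N}{2}\beta\right)-1\right]\right)}\cdot F_{N-k}(t,\beta)\cdot F_k(t,\beta)&\text{if }t\neq 0,\\[2ex]\displaystyle\sum_{k=1}^{N-1}\frac{k}{N}\cdot\frac{\left(N+\binom{N}{2}\beta\right)\left(1-\frac{2k}{N}\right)+1}{\left(N+\binom{N}{2}\beta\right)-1}\cdot F_{N-k}(0,\beta)\cdot F_k(0,\beta)&\text{if }t=0.\end{cases}$$ Then: (a) For fixed $N\geq 2$ and fixed $t\in\mathbb{R}$, the function $\beta\mapsto F_N(t,\beta)$ is holomorphic for $\operatorname{Re}(\beta)>-2/N$. (b) For fixed $N\geq 2$ and fixed $\beta$ with $\operatorname{Re}(\beta)>-2/N$, the function $t\mapsto F_N(t,\beta)$ is defined, smooth, and even on $\mathbb{R}$.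
   Context: Here $\beta$ is a complex variable, $t$ is a real variable, $\sinh$ is the complex hyperbolic sine, and $\binom{N}{2}=N(N-1)/2$. *)

theory Defs
  imports "HOL-Analysis.Analysis"
begin

definition qr_base :: "nat \<Rightarrow> complex \<Rightarrow> complex" where
  "qr_base N \<beta> = of_nat N + of_nat (N choose 2) * \<beta>"

definition qr_num :: "nat \<Rightarrow> nat \<Rightarrow> real \<Rightarrow> complex \<Rightarrow> complex" where
  "qr_num N k t \<beta> =
     (if t \<noteq> 0
      then sinh (of_real (t / 2) * (qr_base N \<beta> * (1 - 2 * of_nat k / of_nat N) + 1))
      else qr_base N \<beta> * (1 - 2 * of_nat k / of_nat N) + 1)"

definition qr_den :: "nat \<Rightarrow> real \<Rightarrow> complex \<Rightarrow> complex" where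
  "qr_den N t \<beta> =
     (if t \<noteq> 0 then sinh (of_real (t / 2) * (qr_base N \<beta> - 1)) else qr_base N \<beta> - 1)"

text \<open>The recurrence, read as a total function: outside \<open>Re \<beta> > -2 / N\<close>, or where a denominator
  vanishes, the value is an artefact of division by zero being zero. That the recurrence is
  meaningful at a point is expressed separately by \<open>qr_defined\<close> below.\<close>

fun qr_F :: "nat \<Rightarrow> real \<Rightarrow> complex \<Rightarrow> complex" where
  "qr_F N t \<beta> =
     (if N < 2 then 1
      else (\<Sum>k\<in>{1..N-1}. of_nat k / of_nat N * (qr_num N k t \<beta> / qr_den N t \<beta>)
              * qr_F (N - k) t \<beta> * qr_F k t \<beta>))"

declare qr_F.simps [simp del]

text \<open>\<open>qr_F N t \<beta>\<close> is genuinely defined by the recurrence: \<open>\<beta>\<close> lies in the prescribed half-plane,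
  no division by zero occurs, and every earlier value that is used is itself defined.\<close>

fun qr_defined :: "nat \<Rightarrow> real \<Rightarrow> complex \<Rightarrow> bool" where
  "qr_defined N t \<beta> \<longleftrightarrow>
     N < 2 \<or>
     (Re \<beta> > - 2 / real N \<and> qr_den N t \<beta> \<noteq> 0 \<and>
      (\<forall>k\<in>{1..N-1}. qr_defined (N - k) t \<beta> \<and> qr_defined k t \<beta>))"

declare qr_defined.simps [simp del]

text \<open>Infinitely differentiable on the real line: every iterated derivative exists everywhere.
  (Requiring \<open>differentiable\<close> at each order matters, since \<open>vector_derivative\<close> is total.)\<close>

definition smooth_real :: "(real \<Rightarrow> 'a::real_normed_vector) \<Rightarrow> bool" where
  "smooth_real f \<longleftrightarrow>
     (\<forall>n t. ((\<lambda>g s. vector_derivative g (at s)) ^^ n) f differentiable (at t))"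

definition even_real :: "(real \<Rightarrow> 'a) \<Rightarrow> bool" where
  "even_real f \<longleftrightarrow> (\<forall>t. f (- t) = f t)"

end

theory Submission
  imports Defs "HOL-Complex_Analysis.Complex_Analysis"
begin

text \<open>For \<open>Re \<beta> > -2/N\<close> the number \<open>N + (N choose 2) \<beta> - 1\<close> has positive real part, while all zeros of
  \<open>sinh\<close> are purely imaginary; so no denominator vanishes for any real \<open>t\<close>, and holomorphy in \<open>\<beta>\<close>
  follows by induction on \<open>N\<close>. Smoothness in \<open>t\<close>, including at the exceptional value \<open>t = 0\<close>, holds
  because \<open>sinh (z w / 2) / z\<close> has a removable singularity at \<open>z = 0\<close> with value \<open>w / 2\<close>: every
  quotient in the recurrence, and hence \<open>F\<^sub>N\<close>, is the restriction to the real line of a function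
  that is analytic in a complex neighbourhood of it.\<close>

lemma sinh_nonzero_if_Re_nonzero:
  fixes z :: complex
  assumes "Re z \<noteq> 0"
  shows "sinh z \<noteq> 0"
proof
  assume "sinh z = 0"
  then have "exp z = 1 \<or> exp z = - 1"
    by (simp add: sinh_zero_iff)
  then have "norm (exp z) = 1"
    by (elim disjE) (simp_all only: norm_minus_cancel norm_one)
  \<comment> \<open>Since \<open>norm (exp z) = exp (Re z)\<close>, norm 1 forces
    \<open>Re z = 0\<close>.\<close>
  with assms show False
    by simp
qed

text \<open>With \<open>N choose 2\<close> written out, \<open>qr_base N \<beta> - 1\<close> factors
  as \<open>(N - 1) * (1 + N * \<beta> / 2)\<close>; the bound on \<open>Re \<beta>\<close> is
  exactly positivity of the real part of the second factor.\<close>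

lemma Re_qr_base_gt_1:
  assumes "N \<ge> 2" "Re \<beta> > - 2 / real N"
  shows "Re (qr_base N \<beta> - 1) > 0"
proof -
  have choose: "real (N choose 2) = real N * (real N - 1) / 2"
    using assms(1) by (simp add: choose_two real_of_nat_div of_nat_diff)
  have "Re (qr_base N \<beta> - 1) = (real N - 1) * (1 + real N * Re \<beta> / 2)"
    unfolding qr_base_def by (simp add: choose field_simps)
  moreover have "1 + real N * Re \<beta> / 2 > 0"
    using assms by (simp add: field_simps)
  ultimately show ?thesis
    using assms(1) by (simp del: minus_complex.simps)
qed

lemma qr_den_nonzero:
  assumes "N \<ge> 2" "Re \<beta> > - 2 / real N"
  shows "qr_den N t \<beta> \<noteq> 0"
proof (cases "t = 0")
  case True
  with Re_qr_base_gt_1[OF assms] show ?thesis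
    by (auto simp: qr_den_def)
next
  case False
  have "Re (of_real (t / 2) * (qr_base N \<beta> - 1)) = t / 2 * Re (qr_base N \<beta> - 1)"
    by (simp del: minus_complex.simps)
  with False Re_qr_base_gt_1[OF assms] have "Re (of_real (t / 2) * (qr_base N \<beta> - 1)) \<noteq> 0"
    by simp
  then show ?thesis
    using False by (simp add: qr_den_def sinh_nonzero_if_Re_nonzero del: times_complex.simps)
qed

text \<open>The half-planes shrink as the index grows, so the induction hypotheses for smaller
  indices apply on the half-plane of \<open>N\<close>. Index 0 is excluded because
  \<open>2 / 0 = 0\<close> would make its half-plane \<open>Re \<beta> > 0\<close>.\<close>

lemma half_plane_mono:
  assumes "0 < k" "k \<le> N" "x > - 2 / real N"
  shows "x > - 2 / real k"
proof -
  have "2 / real N \<le> 2 / real k"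
    using assms by (intro divide_left_mono) auto
  with assms(3) show ?thesis by simp
qed

lemma qr_defined_half_plane:
  assumes "Re \<beta> > - 2 / real N"
  shows "qr_defined N t \<beta>"
  using assms
proof (induction N rule: less_induct)
  case (less N)
  show ?case
  proof (cases "N < 2")
    case False
    have "qr_defined k t \<beta>" if "0 < k" "k < N" for k
      using that less.IH half_plane_mono[of k N] less.prems by simp
    with False less.prems show ?thesis
      by (subst qr_defined.simps) (use qr_den_nonzero[of N \<beta> t] in auto)
  qed (subst qr_defined.simps, simp)
qed

lemma qr_F_trivial: "N < 2 \<Longrightarrow> qr_F N t \<beta> = 1"
  by (subst qr_F.simps) simp

lemma qr_F_rec:
  assumes "N \<ge> 2"
  shows "qr_F N t \<beta> = (\<Sum>k\<in>{1..N-1}. of_nat k / of_nat N * (qr_num N k t \<beta> / qr_den N t \<beta>)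
              * qr_F (N - k) t \<beta> * qr_F k t \<beta>)"
  using assms by (subst qr_F.simps) simp

lemma analytic_on_qr_num [analytic_intros]: "qr_num N k t analytic_on A"
  unfolding qr_num_def qr_base_def by (cases "t = 0") (auto intro!: analytic_intros)

lemma analytic_on_qr_den [analytic_intros]: "qr_den N t analytic_on A"
  unfolding qr_den_def qr_base_def by (cases "t = 0") (auto intro!: analytic_intros)

lemma analytic_on_qr_F: "qr_F N t analytic_on {\<beta>. Re \<beta> > - 2 / real N}"
proof (induction N rule: less_induct)
  case (less N)
  show ?case
  proof (cases "N < 2")
    case True
    then have "qr_F N t = (\<lambda>_. 1)"
      by (simp add: fun_eq_iff qr_F_trivial)
    then show ?thesis by simp
  next
    case False
    let ?H = "{\<beta>. Re \<beta> > - 2 / real N}"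
    \<comment> \<open>This serves both factors of each summand: for \<open>k\<close> in
      \<open>{1..N-1}\<close>, also \<open>N - k\<close> lies strictly between 0 and
      \<open>N\<close>.\<close>
    have *: "qr_F k t analytic_on ?H" if "0 < k" "k < N" for k
      by (rule analytic_on_subset[OF less.IH[OF that(2)]])
        (use that in \<open>auto dest: half_plane_mono[of k N]\<close>)
    have "qr_F N t = (\<lambda>\<beta>. \<Sum>k\<in>{1..N-1}. of_nat k / of_nat N * (qr_num N k t \<beta> / qr_den N t \<beta>)
              * qr_F (N - k) t \<beta> * qr_F k t \<beta>)"
      using False by (simp add: fun_eq_iff qr_F_rec)
    moreover have "\<dots> analytic_on ?H"
      using False by (intro analytic_intros *) (auto simp: qr_den_nonzero)
    ultimately show ?thesis by simp
  qed
qed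

text \<open>For \<open>t \<noteq> 0\<close> numerator and denominator are both odd in
  \<open>t\<close>, so the two signs cancel.\<close>

lemma qr_ratio_even: "qr_num N k (- t) \<beta> / qr_den N (- t) \<beta> = qr_num N k t \<beta> / qr_den N t \<beta>"
  by (simp add: qr_num_def qr_den_def)

lemma qr_F_even: "qr_F N (- t) \<beta> = qr_F N t \<beta>"
proof (induction N rule: less_induct)
  case (less N)
  then show ?case
    by (cases "N < 2") (auto simp: qr_F_trivial qr_F_rec qr_ratio_even intro!: sum.cong)
qed

text \<open>Complex derivatives of all orders exist on an open set around the real line, and
  differentiating along the line commutes with restricting to it.\<close>

lemma smooth_real_restrict_analytic:
  fixes G :: "complex \<Rightarrow> complex"
  assumes "G analytic_on \<real>"
  shows "smooth_real (\<lambda>t. G (of_real t))"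
proof -
  obtain U where U: "open U" "\<real> \<subseteq> U" "G holomorphic_on U"
    using assms by (auto simp: analytic_on_holomorphic)
  have deriv: "((\<lambda>s. (deriv ^^ n) G (of_real s)) has_vector_derivative
      (deriv ^^ Suc n) G (of_real t)) (at t)" for n t
  proof -
    have "(deriv ^^ n) G holomorphic_on U"
      using U by (intro holomorphic_higher_deriv)
    then have "((deriv ^^ n) G has_field_derivative (deriv ^^ Suc n) G (of_real t)) (at (of_real t))"
      using U by (auto intro!: holomorphic_derivI)
    then show ?thesis
      by (rule has_vector_derivative_real_field)
  qed
  have iter: "((\<lambda>g s. vector_derivative g (at s)) ^^ n) (\<lambda>t. G (of_real t))
      = (\<lambda>t. (deriv ^^ n) G (of_real t))" for n
  proof (induction n)
    case (Suc n)
    then show ?case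
      using vector_derivative_at[OF deriv[of n]] by simp
  qed simp
  show ?thesis
    unfolding smooth_real_def iter using deriv by (blast intro: differentiableI_vector)
qed

definition sinh_quot :: "complex \<Rightarrow> complex \<Rightarrow> complex" where
  "sinh_quot w z = (if z = 0 then w / 2 else sinh (z / 2 * w) / z)"

lemma analytic_on_sinh_quot [analytic_intros]: "sinh_quot w analytic_on A"
proof -
  have "sinh_quot w holomorphic_on UNIV"
  \<comment> \<open>As \<open>sinh 0 = 0\<close>, \<open>sinh_quot w\<close> is the difference
    quotient at 0 of \<open>sinh (z / 2 * w)\<close>, completed by the derivative
    \<open>w / 2\<close> there.\<close>
  proof (rule pole_theorem_open_0)
    show "(\<lambda>z. sinh (z / 2 * w)) holomorphic_on UNIV"
      by (intro analytic_imp_holomorphic analytic_intros) auto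
    have "((\<lambda>z. sinh (z / 2 * w)) has_field_derivative w / 2) (at 0)"
      by (auto intro!: derivative_eq_intros)
    then show "sinh_quot w 0 = deriv (\<lambda>z. sinh (z / 2 * w)) 0"
      by (simp add: sinh_quot_def DERIV_imp_deriv)
  qed (auto simp: sinh_quot_def)
  then have "sinh_quot w analytic_on UNIV"
    by (simp add: analytic_on_open)
  then show ?thesis
    by (rule analytic_on_subset) simp
qed

text \<open>The factors \<open>2\<close> and \<open>1 / z\<close> cancel in the quotient of two such functions, so that the two cases
  of the recurrence merge into one formula.\<close>

lemma qr_num_eq_sinh_quot:
  "qr_num N k t \<beta> = (if t = 0 then 2 else of_real t)
    * sinh_quot (qr_base N \<beta> * (1 - 2 * of_nat k / of_nat N) + 1) (of_real t)"
  by (simp add: qr_num_def sinh_quot_def)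

lemma qr_den_eq_sinh_quot:
  "qr_den N t \<beta> = (if t = 0 then 2 else of_real t) * sinh_quot (qr_base N \<beta> - 1) (of_real t)"
  by (simp add: qr_den_def sinh_quot_def)

lemma qr_F_analytic_extension:
  assumes "Re \<beta> > - 2 / real N"
  shows "\<exists>G. G analytic_on \<real> \<and> (\<forall>t. qr_F N t \<beta> = G (of_real t))"
  using assms
proof (induction N rule: less_induct)
  case (less N)
  show ?case
  proof (cases "N < 2")
    case True
    then show ?thesis
      by (intro exI[of _ "\<lambda>_. 1"]) (simp add: qr_F_trivial)
  next
    case False
    have "\<exists>G. G analytic_on \<real> \<and> (\<forall>t. qr_F k t \<beta> = G (of_real t))" if "0 < k" "k < N" for k
      using that less.IH half_plane_mono[of k N] less.prems by simp
    then obtain G where G: "\<And>k. 0 < k \<Longrightarrow> k < N \<Longrightarrow> G k analytic_on \<real>"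
      "\<And>k t. 0 < k \<Longrightarrow> k < N \<Longrightarrow> qr_F k t \<beta> = G k (of_real t)"
      by metis
    define num where
      "num = (\<lambda>k. sinh_quot (qr_base N \<beta> * (1 - 2 * of_nat k / of_nat N) + 1))"
    define den where "den = sinh_quot (qr_base N \<beta> - 1)"
    let ?G = "\<lambda>z. \<Sum>k\<in>{1..N-1}. of_nat k / of_nat N * (num k z / den z) * G (N - k) z * G k z"
    \<comment> \<open>Off the real line \<open>den\<close> may vanish, but analyticity of the
      quotient on \<open>\<real>\<close> only asks for nonzero values on \<open>\<real>\<close>
      itself; continuity supplies the neighbourhood.\<close>
    have den: "den z \<noteq> 0" if "z \<in> \<real>" for z
    proof -
      obtain t where "z = of_real t"
        using \<open>z \<in> \<real>\<close> by (auto elim: Reals_cases)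
      with qr_den_nonzero[of N \<beta> t] False less.prems show ?thesis
        by (auto simp: qr_den_eq_sinh_quot den_def)
    qed
    have "num k analytic_on \<real>" "den analytic_on \<real>" for k
      unfolding num_def den_def by (intro analytic_intros)+
    then have "?G analytic_on \<real>"
      by (intro analytic_intros G den) auto
    moreover have "qr_F N t \<beta> = ?G (of_real t)" for t
    proof -
      have "qr_num N k t \<beta> / qr_den N t \<beta> = num k (of_real t) / den (of_real t)" for k
        by (simp add: qr_num_eq_sinh_quot qr_den_eq_sinh_quot num_def den_def)
      then show ?thesis
        using False by (auto simp: qr_F_rec G intro!: sum.cong)
    qed
    ultimately show ?thesis by blast
  qed
qed

theorem lemma2p4:
  fixes N :: nat
  assumes "N \<ge> 2"
  shows "(\<forall>t::real. (\<lambda>\<beta>. qr_F N t \<beta>) holomorphic_on {\<beta>. Re \<beta> > - 2 / real N}) \<and>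
         (\<forall>\<beta>::complex. Re \<beta> > - 2 / real N \<longrightarrow>
            (\<forall>t::real. qr_defined N t \<beta>) \<and>
            smooth_real (\<lambda>t. qr_F N t \<beta>) \<and>
            even_real (\<lambda>t. qr_F N t \<beta>))"
proof (intro conjI allI impI)
  show "(\<lambda>\<beta>. qr_F N t \<beta>) holomorphic_on {\<beta>. Re \<beta> > - 2 / real N}" for t
    by (rule analytic_imp_holomorphic[OF analytic_on_qr_F])
next
  fix \<beta> :: complex
  assume \<beta>: "Re \<beta> > - 2 / real N"
  show "qr_defined N t \<beta>" for t
    by (rule qr_defined_half_plane[OF \<beta>])
  obtain G where "G analytic_on \<real>" "\<And>t. qr_F N t \<beta> = G (of_real t)"
    using qr_F_analytic_extension[OF \<beta>] by blast
  then show "smooth_real (\<lambda>t. qr_F N t \<beta>)"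
    using smooth_real_restrict_analytic by simp
  show "even_real (\<lambda>t. qr_F N t \<beta>)"
    by (simp add: even_real_def qr_F_even)
qed

end
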